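(* Consider the proposed procedure $(\widetilde{\mathcal X},\widetilde T)$ with blocks $\Xi_1,\Xi_2$ and thresholds $b_2\ge b_1\ge1$, $d\ge1$. If $n\in\mathbb N$ is odd, let $B_n=\{\tau(S_n;d)<\sigma(S_n;b_2)\}$. Then for every odd $n\in\mathbb N$, on the event $\{S_n<\widetilde T\}$ we have $$\mathsf P(L_{S_n}=0\mid\mathcal F_{S_n})\le\frac1{1+b_1},\qquad\mathsf P(B_n,\,L_{S_n}=1\mid\mathcal F_{S_n})\le\frac1d\,\mathsf P(L_{S_n}=1\mid\mathcal F_{S_n}).$$
   Context: Setup. Fix $2\le K<\infty$, $[K]=\{1,\dots,K\}$, $\mathbb N=\{1,2,\dots\}$. There is a latent process $L_t\in\{0,1\}$, $t\ge0$, with $L_t=0$ for $t<\Theta$ and $L_t=1$ for $t\ge\Theta$ ($\Theta$ is the change-point). At each $t\in\mathbb N$ a treatment $X_t\in[K]$ is selected and a response $Y_t$ in a Polish space $\mathbb Y$ is observed; $\mathcal F_t=\sigma(X_s,Y_s:1\le s\le t)$, $\mathcal F_0$ trivial. An assignment rule $\mathcal X=\{X_t\}$ has $X_1$ deterministic and $X_t$ a measurable function of $X_1,\dots,X_{t-1},Y_1,\dots,Y_{t-1}$. Response model: for each $x\in[K]$, $f_x,g_x$ are densities with respect to a $\sigma$-finite measure $\mu$ on $\mathbb Y$; given $X_t=x,L_t=i,\mathcal F_{t-1},L_0,\dots,L_{t-1}$, $Y_t$ has density $f_x$ if $i=0$, $g_x$ if $i=1$. Change-point model: $\pi_0\in[0,1)$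 and functions $\pi_t:[K]^t\to[0,1)$ with $\mathsf P(L_0=1)=\pi_0$ and $\mathsf P(L_t=1\mid L_{t-1}=0,\mathcal F_{t-1},X_t)=\Pi_t:=\pi_t(X_1,\dots,X_t)$. Posterior odds: $\Gamma_t=\mathsf P(L_t=1|\mathcal F_t)/\mathsf P(L_t=0|\mathcal F_t)$; $\Lambda_t=g_{X_t}(Y_t)/f_{X_t}(Y_t)$. A block of length $\ell$ is $\Xi\in[K]^\ell$, extended cyclically by $\Xi(j\ell+i)=\Xi(i)$. Proposed procedure $(\widetilde{\mathcal X},\widetilde T)$. Let $\sigma(t;b)=\inf\{s\ge0:\Gamma_{t+s}\ge b\}$, $\tau(t;d)=\inf\{s\ge1:\prod_{j=1}^s\Lambda_{t+j}\le1/d\}$. Put $S_0=0$ and for $m\ge1$: $S_{2m-1}=S_{2m-2}+\sigma(S_{2m-2};b_1)$ and $S_{2m}=S_{2m-1}+\min\{\sigma(S_{2m-1};b_2),\tau(S_{2m-1};d)\}$. Treatments: $\widetilde X_t=\Xi_1(t-S_{2m-2})$ if $t\in(S_{2m-2},S_{2m-1}]$, $\widetilde X_t=\Xi_2(t-S_{2m-1})$ if $t\in(S_{2m-1},S_{2m}]$. Stopping: $\widetilde T=S_{2N}$, $N=\inf\{m\ge1:\sigma(S_{2m-1};b_2)\le\tau(S_{2m-1};d)\}$. *)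

theory Defs
  imports "HOL-Probability.Probability"
begin

text \<open>The latent state; \<open>\<Theta> \<omega> = \<infinity>\<close> means that the change never occurs.\<close>

definition latent :: "('w \<Rightarrow> enat) \<Rightarrow> nat \<Rightarrow> 'w \<Rightarrow> nat" where
  "latent \<Theta> t \<omega> = (if enat t < \<Theta> \<omega> then 0 else 1)"

text \<open>The filtration is indexed by \<^typ>\<open>enat\<close> so that the library's
  \<open>filtration.pre_sigma\<close> applies to stopping times that may be infinite.\<close>

definition obs ::
  "'w measure \<Rightarrow> (nat \<Rightarrow> 'w \<Rightarrow> nat) \<Rightarrow> (nat \<Rightarrow> 'w \<Rightarrow> 'y::topological_space) \<Rightarrow> enat \<Rightarrow> 'w measure"
where
  "obs M X Y t = sigma (space M)
     (\<Union>s\<in>{s. 1 \<le> s \<and> enat s \<le> t}.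
        sets (vimage_algebra (space M) (X s) (count_space UNIV)) \<union>
        sets (vimage_algebra (space M) (Y s) borel))"

lemma filtration_obs: "filtration (space M) (obs M X Y)"
proof
  fix i j :: enat assume "i \<le> j"
  let ?G = "\<lambda>t. \<Union>s\<in>{s. 1 \<le> s \<and> enat s \<le> t}.
        sets (vimage_algebra (space M) (X s) (count_space UNIV)) \<union>
        sets (vimage_algebra (space M) (Y s) borel)"
  have "?G t \<subseteq> Pow (space M)" for t
    by (auto simp: sets_vimage_algebra2)
  then have eq: "sets (obs M X Y t) = sigma_sets (space M) (?G t)" for t
    unfolding obs_def by (rule sets_measure_of)
  have "?G i \<subseteq> ?G j"
    using \<open>i \<le> j\<close> by (intro UN_mono) (auto intro: order_trans)
  then show "sets (obs M X Y i) \<le> sets (obs M X Y j)"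
    unfolding eq by (rule sigma_sets_mono')
qed (auto simp: obs_def sets_vimage_algebra2 intro!: space_measure_of)

text \<open>The \<open>\<sigma>\<close>-algebra generated by the observations up to time \<open>t - 1\<close>, the treatment \<open>X\<^sub>t\<close> and
  the latent states \<open>L\<^sub>s\<close>, \<open>s \<in> I\<close>.\<close>

definition obs_latent ::
  "'w measure \<Rightarrow> (nat \<Rightarrow> 'w \<Rightarrow> nat) \<Rightarrow> (nat \<Rightarrow> 'w \<Rightarrow> 'y::topological_space) \<Rightarrow> ('w \<Rightarrow> enat) \<Rightarrow>
   nat \<Rightarrow> nat set \<Rightarrow> 'w measure"
where
  "obs_latent M X Y \<Theta> t I = sigma (space M)
     (sets (obs M X Y (enat (t - 1))) \<union>
      sets (vimage_algebra (space M) (X t) (count_space UNIV)) \<union>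
      (\<Union>s\<in>I. sets (vimage_algebra (space M) (latent \<Theta> s) (count_space UNIV))))"

definition cprob :: "'w measure \<Rightarrow> 'w measure \<Rightarrow> ('w \<Rightarrow> bool) \<Rightarrow> 'w \<Rightarrow> real" where
  "cprob M G P = real_cond_exp M G (indicator {\<omega> \<in> space M. P \<omega>})"

definition assignment_rule ::
  "'w measure \<Rightarrow> nat \<Rightarrow> (nat \<Rightarrow> 'w \<Rightarrow> nat) \<Rightarrow> (nat \<Rightarrow> 'w \<Rightarrow> 'y::topological_space) \<Rightarrow> bool"
where
  "assignment_rule M K X Y \<longleftrightarrow>
     (\<forall>t\<ge>1. \<forall>\<omega>\<in>space M. X t \<omega> \<in> {1..K}) \<and>
     (\<exists>x. \<forall>\<omega>\<in>space M. X 1 \<omega> = x) \<and>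
     (\<forall>t\<ge>2. \<exists>h \<in> (\<Pi>\<^sub>M s\<in>{1..<t}. count_space UNIV \<Otimes>\<^sub>M borel) \<rightarrow>\<^sub>M count_space UNIV.
        \<forall>\<omega>\<in>space M. X t \<omega> = h (\<lambda>s\<in>{1..<t}. (X s \<omega>, Y s \<omega>)))"

text \<open>The functions \<open>\<pi>\<^sub>t : [K]\<^sup>t \<rightarrow> [0,1)\<close>, \<open>t \<ge> 0\<close>, are given by a single function \<open>p\<close> on lists:
  \<open>\<pi>\<^sub>t(x\<^sub>1,\<dots>,x\<^sub>t) = p [x\<^sub>1,\<dots>,x\<^sub>t]\<close> and \<open>\<pi>\<^sub>0 = p []\<close>.\<close>

locale change_point_model = prob_space M + mu: sigma_finite_measure \<mu>
  for M :: "'w measure" and \<mu> :: "'y::polish_space measure" +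
  fixes K :: nat
    and f g :: "nat \<Rightarrow> 'y \<Rightarrow> real"
    and p :: "nat list \<Rightarrow> real"
    and \<Theta> :: "'w \<Rightarrow> enat"
    and X :: "nat \<Rightarrow> 'w \<Rightarrow> nat"
    and Y :: "nat \<Rightarrow> 'w \<Rightarrow> 'y"
  assumes K: "2 \<le> K"
    and sets_mu: "sets \<mu> = sets borel"
    and f_density: "\<And>x. x \<in> {1..K} \<Longrightarrow>
      f x \<in> borel_measurable \<mu> \<and> (\<forall>y. 0 \<le> f x y) \<and> (\<integral>\<^sup>+ y. ennreal (f x y) \<partial>\<mu>) = 1"
    and g_density: "\<And>x. x \<in> {1..K} \<Longrightarrow>
      g x \<in> borel_measurable \<mu> \<and> (\<forall>y. 0 \<le> g x y) \<and> (\<integral>\<^sup>+ y. ennreal (g x y) \<partial>\<mu>) = 1"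
    and p_range: "\<And>xs. set xs \<subseteq> {1..K} \<Longrightarrow> 0 \<le> p xs \<and> p xs < 1"
    and \<Theta>_measurable: "\<Theta> \<in> M \<rightarrow>\<^sub>M count_space UNIV"
    and Y_measurable: "\<And>t. 1 \<le> t \<Longrightarrow> Y t \<in> M \<rightarrow>\<^sub>M borel"
    and assignment: "assignment_rule M K X Y"
    and response: "\<And>t A. 1 \<le> t \<Longrightarrow> A \<in> sets borel \<Longrightarrow>
      AE \<omega> in M. cprob M (obs_latent M X Y \<Theta> t {0..t}) (\<lambda>\<omega>. Y t \<omega> \<in> A) \<omega> =
        (LINT y:A|\<mu>. if latent \<Theta> t \<omega> = 0 then f (X t \<omega>) y else g (X t \<omega>) y)"
    and change_init: "prob {\<omega> \<in> space M. latent \<Theta> 0 \<omega> = 1} = p []"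
    and change_step: "\<And>t. 1 \<le> t \<Longrightarrow>
      AE \<omega> in M. latent \<Theta> (t - 1) \<omega> = 0 \<longrightarrow>
        cprob M (obs_latent M X Y \<Theta> t {t - 1}) (\<lambda>\<omega>. latent \<Theta> t \<omega> = 1) \<omega> =
        p (map (\<lambda>s. X s \<omega>) [1..<Suc t])"

text \<open>Odds and likelihood ratios take values in \<^typ>\<open>ennreal\<close>, where \<open>a / 0 = \<infinity>\<close> for \<open>a > 0\<close>.
  As conditional probabilities are determined only almost surely, \<open>\<Gamma>\<close> may be any adapted version.\<close>

definition posterior_odds ::
  "'w measure \<Rightarrow> (nat \<Rightarrow> 'w \<Rightarrow> nat) \<Rightarrow> (nat \<Rightarrow> 'w \<Rightarrow> 'y::topological_space) \<Rightarrow> ('w \<Rightarrow> enat) \<Rightarrow>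
   (nat \<Rightarrow> 'w \<Rightarrow> ennreal) \<Rightarrow> bool"
where
  "posterior_odds M X Y \<Theta> \<Gamma> \<longleftrightarrow>
     (\<forall>t. \<Gamma> t \<in> borel_measurable (obs M X Y (enat t)) \<and>
       (AE \<omega> in M. \<Gamma> t \<omega> =
          ennreal (cprob M (obs M X Y (enat t)) (\<lambda>\<omega>. latent \<Theta> t \<omega> = 1) \<omega>) /
          ennreal (cprob M (obs M X Y (enat t)) (\<lambda>\<omega>. latent \<Theta> t \<omega> = 0) \<omega>)))"

definition lik_ratio ::
  "(nat \<Rightarrow> 'y \<Rightarrow> real) \<Rightarrow> (nat \<Rightarrow> 'y \<Rightarrow> real) \<Rightarrow> (nat \<Rightarrow> 'w \<Rightarrow> nat) \<Rightarrow> (nat \<Rightarrow> 'w \<Rightarrow> 'y) \<Rightarrow>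
   nat \<Rightarrow> 'w \<Rightarrow> ennreal"
where
  "lik_ratio f g X Y t \<omega> = ennreal (g (X t \<omega>) (Y t \<omega>)) / ennreal (f (X t \<omega>) (Y t \<omega>))"

text \<open>The infimum of the empty set is \<open>\<infinity>\<close>, and both waiting times are set to \<open>\<infinity>\<close> when the
  starting time is \<open>\<infinity>\<close>.\<close>

definition sigma_time :: "(nat \<Rightarrow> 'w \<Rightarrow> ennreal) \<Rightarrow> real \<Rightarrow> enat \<Rightarrow> 'w \<Rightarrow> enat" where
  "sigma_time \<Gamma> b t \<omega> = (case t of
       enat k \<Rightarrow> Inf (enat ` {s. \<Gamma> (k + s) \<omega> \<ge> ennreal b})
     | \<infinity> \<Rightarrow> \<infinity>)"

definition tau_time :: "(nat \<Rightarrow> 'w \<Rightarrow> ennreal) \<Rightarrow> real \<Rightarrow> enat \<Rightarrow> 'w \<Rightarrow> enat" where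
  "tau_time \<Lambda> d t \<omega> = (case t of
       enat k \<Rightarrow> Inf (enat ` {s. 1 \<le> s \<and> (\<Prod>j=1..s. \<Lambda> (k + j) \<omega>) \<le> ennreal (1 / d)})
     | \<infinity> \<Rightarrow> \<infinity>)"

primrec stage_time ::
  "(nat \<Rightarrow> 'w \<Rightarrow> ennreal) \<Rightarrow> (nat \<Rightarrow> 'w \<Rightarrow> ennreal) \<Rightarrow> real \<Rightarrow> real \<Rightarrow> real \<Rightarrow> nat \<Rightarrow> 'w \<Rightarrow> enat"
where
  "stage_time \<Gamma> \<Lambda> b1 b2 d 0 \<omega> = 0"
| "stage_time \<Gamma> \<Lambda> b1 b2 d (Suc n) \<omega> =
     (let s = stage_time \<Gamma> \<Lambda> b1 b2 d n \<omega> in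
      s + (if even n then sigma_time \<Gamma> b1 s \<omega>
           else min (sigma_time \<Gamma> b2 s \<omega>) (tau_time \<Lambda> d s \<omega>)))"

definition num_cycles ::
  "(nat \<Rightarrow> 'w \<Rightarrow> ennreal) \<Rightarrow> (nat \<Rightarrow> 'w \<Rightarrow> ennreal) \<Rightarrow> real \<Rightarrow> real \<Rightarrow> real \<Rightarrow> 'w \<Rightarrow> enat"
where
  "num_cycles \<Gamma> \<Lambda> b1 b2 d \<omega> =
     Inf (enat ` {m. 1 \<le> m \<and>
       sigma_time \<Gamma> b2 (stage_time \<Gamma> \<Lambda> b1 b2 d (2 * m - 1) \<omega>) \<omega>
         \<le> tau_time \<Lambda> d (stage_time \<Gamma> \<Lambda> b1 b2 d (2 * m - 1) \<omega>) \<omega>})"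

definition alarm_time ::
  "(nat \<Rightarrow> 'w \<Rightarrow> ennreal) \<Rightarrow> (nat \<Rightarrow> 'w \<Rightarrow> ennreal) \<Rightarrow> real \<Rightarrow> real \<Rightarrow> real \<Rightarrow> 'w \<Rightarrow> enat"
where
  "alarm_time \<Gamma> \<Lambda> b1 b2 d \<omega> = (case num_cycles \<Gamma> \<Lambda> b1 b2 d \<omega> of
       enat m \<Rightarrow> stage_time \<Gamma> \<Lambda> b1 b2 d (2 * m) \<omega>
     | \<infinity> \<Rightarrow> \<infinity>)"

definition block :: "nat \<Rightarrow> nat list \<Rightarrow> bool" where
  "block K \<Xi> \<longleftrightarrow> \<Xi> \<noteq> [] \<and> set \<Xi> \<subseteq> {1..K}"

text \<open>Cyclic extension of a block; positions are counted from 1.\<close>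

definition cyclic :: "nat list \<Rightarrow> nat \<Rightarrow> nat" where
  "cyclic \<Xi> i = \<Xi> ! ((i - 1) mod length \<Xi>)"

text \<open>The times \<open>t\<close> after the alarm lie in none of the intervals, so the rule leaves the
  treatments there unspecified.\<close>

definition proposed_rule ::
  "'w measure \<Rightarrow> (nat \<Rightarrow> 'w \<Rightarrow> nat) \<Rightarrow> (nat \<Rightarrow> 'w \<Rightarrow> ennreal) \<Rightarrow> (nat \<Rightarrow> 'w \<Rightarrow> ennreal) \<Rightarrow>
   nat list \<Rightarrow> nat list \<Rightarrow> real \<Rightarrow> real \<Rightarrow> real \<Rightarrow> bool"
where
  "proposed_rule M X \<Gamma> \<Lambda> \<Xi>1 \<Xi>2 b1 b2 d \<longleftrightarrow>
     (\<forall>\<omega>\<in>space M. \<forall>t m. 1 \<le> m \<longrightarrow>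
        (let S = (\<lambda>n. stage_time \<Gamma> \<Lambda> b1 b2 d n \<omega>) in
          (S (2 * m - 2) < enat t \<and> enat t \<le> S (2 * m - 1) \<longrightarrow>
             X t \<omega> = cyclic \<Xi>1 (t - the_enat (S (2 * m - 2)))) \<and>
          (S (2 * m - 1) < enat t \<and> enat t \<le> S (2 * m) \<longrightarrow>
             X t \<omega> = cyclic \<Xi>2 (t - the_enat (S (2 * m - 1))))))"

end

theory Submission
  imports Defs
begin

text \<open>Both bounds are checked on each piece \<open>{S\<^sub>n = k}\<close>: an event of \<open>\<F>\<close> at time \<open>S\<^sub>n\<close> contained
  in it belongs to \<open>\<F>\<^sub>k\<close>, so it suffices to compare integrals over events \<open>E \<in> \<F>\<^sub>k\<close>.
  For odd \<open>n\<close> the odds satisfy \<open>\<Gamma>\<^sub>k \<ge> b\<^sub>1\<close> on such a piece, which is the first bound. For the second,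
  on \<open>{L\<^sub>k = 1}\<close> all later responses have density \<open>g\<close>, so the products of the inverse likelihood
  ratios \<open>f/g\<close> form a nonnegative supermartingale started at 1, and the maximal inequality bounds
  the probability that it ever reaches \<open>d\<close> by \<open>1/d\<close>.\<close>

section \<open>Comparison of conditional expectations and a maximal inequality\<close>

text \<open>The points of \<open>D\<close> where the inequality fails form an event of
  \<open>F\<close>, so that event may itself be used as the test event. There the difference is
  strictly positive but has nonpositive integral, which makes the event null. Restricting to
  \<open>D\<close> allows each value of a stopping time to be treated separately.\<close>

lemma (in finite_measure_subalgebra) AE_real_cond_exp_le_on:
  assumes D: "D \<in> sets F"
    and int: "integrable M u" "integrable M v"
    and le: "\<And>E. E \<in> sets F \<Longrightarrow> E \<subseteq> D \<Longrightarrow> (LINT x:E|M. u x) \<le> (LINT x:E|M. v x)"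
  shows "AE x in M. x \<in> D \<longrightarrow> real_cond_exp M F u x \<le> real_cond_exp M F v x"
proof -
  let ?u = "real_cond_exp M F u" and ?v = "real_cond_exp M F v"
  define E where "E = {x \<in> D. ?v x < ?u x}"
  have "E = D \<inter> {x \<in> space F. ?v x < ?u x}"
    using sets.sets_into_space[OF D] by (auto simp: E_def)
  then have EF: "E \<in> sets F"
    using D by simp
  then have EM: "E \<in> sets M"
    using subalg by (auto simp: subalgebra_def)
  have set_int: "set_integrable M E ?u" "set_integrable M E ?v"
    unfolding set_integrable_def
    by (rule integrable_mult_indicator[OF EM real_cond_exp_int(1)[OF int(1)]]
        integrable_mult_indicator[OF EM real_cond_exp_int(1)[OF int(2)]])+
  \<comment> \<open>The definition of \<open>E\<close> fixes the sign, so an integral that is at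
    most 0 has to vanish together with its integrand.\<close>
  have nonneg: "0 \<le> indicator E x * (?u x - ?v x)" for x
    by (auto simp: E_def indicator_def)
  have int_diff: "integrable M (\<lambda>x. indicator E x * (?u x - ?v x))"
    using set_integral_diff(1)[OF set_int] by (simp add: set_integrable_def)
  have "(LINT x|M. indicator E x * (?u x - ?v x)) = (LINT x:E|M. ?u x) - (LINT x:E|M. ?v x)"
    using set_integral_diff(2)[OF set_int] by (simp add: set_lebesgue_integral_def)
  also have "\<dots> \<le> 0"
    using le[OF EF] real_cond_exp_intA[OF int(1) EF] real_cond_exp_intA[OF int(2) EF]
    by (auto simp: E_def)
  finally have "(LINT x|M. indicator E x * (?u x - ?v x)) = 0"
    using nonneg by (intro antisym integral_nonneg) auto
  then have "AE x in M. indicator E x * (?u x - ?v x) = 0"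
    using int_diff nonneg by (subst (asm) integral_nonneg_eq_0_iff_AE) auto
  then show ?thesis
    by eventually_elim (auto simp: E_def indicator_def split: if_splits)
qed

text \<open>Stop at the first passage to level \<open>c\<close>: paths that have crossed contribute
  at least \<open>c\<close>, the others keep their current value, and the total never increases. The
  supermartingale property is stated through integrals over events of \<open>G s\<close>, so
  infinite values are allowed and no integrability is involved. The set \<open>A\<close> supplies
  the version conditional on time 0.\<close>

lemma nn_supermartingale_maximal:
  fixes Z :: "nat \<Rightarrow> 'a \<Rightarrow> ennreal"
  assumes sub: "\<And>s. subalgebra M (G s)"
    and mono: "\<And>s. sets (G s) \<subseteq> sets (G (Suc s))"
    and Z: "\<And>s. Z s \<in> borel_measurable (G s)"
    and super: "\<And>s E. E \<in> sets (G s) \<Longrightarrow> (\<integral>\<^sup>+x\<in>E. Z (Suc s) x \<partial>M) \<le> (\<integral>\<^sup>+x\<in>E. Z s x \<partial>M)"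
    and A: "A \<in> sets (G 0)"
  shows "c * emeasure M {x \<in> A. \<exists>s. c \<le> Z s x} \<le> (\<integral>\<^sup>+x\<in>A. Z 0 x \<partial>M)"
proof -
  have spG: "space (G s) = space M" and GM: "sets (G s) \<subseteq> sets M" for s
    using sub by (auto simp: subalgebra_def)
  have ZM[measurable]: "Z s \<in> borel_measurable M" for s
    using measurable_from_subalg[OF sub Z] .
  have AG: "A \<in> sets (G s)" for s
    using A mono by (induction s) auto
  have [measurable]: "A \<in> sets M" and AM: "A \<subseteq> space M"
    using AG GM sets.sets_into_space by blast+
  \<comment> \<open>The paths that have not crossed by time \<open>N\<close>. This event is known at
    time \<open>N\<close>, hence admissible in \<open>super\<close>.\<close>
  define C where "C N = {x \<in> A. \<forall>s\<le>N. Z s x < c}" for N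
  have CG: "C N \<in> sets (G N)" for N
  proof (induction N)
    case 0
    have "C 0 = A \<inter> {x \<in> space (G 0). Z 0 x < c}"
      using AM by (auto simp: C_def spG)
    then show ?case
      using A Z by simp
  next
    case (Suc N)
    have "C (Suc N) = C N \<inter> {x \<in> space (G (Suc N)). Z (Suc N) x < c}"
      using AM by (auto simp: C_def spG le_Suc_eq)
    moreover have "C N \<in> sets (G (Suc N))"
      using Suc mono by blast
    moreover have "{x \<in> space (G (Suc N)). Z (Suc N) x < c} \<in> sets (G (Suc N))"
      using Z[of "Suc N"] by simp
    ultimately show ?case
      by simp
  qed
  then have CM[measurable]: "C N \<in> sets M" for N
    using GM by blast
  have "c * emeasure M (A - C N) + (\<integral>\<^sup>+x\<in>C N. Z N x \<partial>M) \<le> (\<integral>\<^sup>+x\<in>A. Z 0 x \<partial>M)" for N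
  proof (induction N)
    case 0
    have "c * emeasure M (A - C 0) + (\<integral>\<^sup>+x\<in>C 0. Z 0 x \<partial>M) =
        (\<integral>\<^sup>+x. c * indicator (A - C 0) x + Z 0 x * indicator (C 0) x \<partial>M)"
      by (subst nn_integral_add) (auto simp: nn_integral_cmult_indicator)
    also have "\<dots> \<le> (\<integral>\<^sup>+x\<in>A. Z 0 x \<partial>M)"
      by (intro nn_integral_mono) (auto simp: C_def indicator_def)
    finally show ?case .
  next
    case (Suc N)
    have sub: "C (Suc N) \<subseteq> C N" "C N \<subseteq> A"
      by (auto simp: C_def)
    have split: "A - C (Suc N) = (A - C N) \<union> (C N - C (Suc N))"
      using sub by auto
    have "c * emeasure M (A - C (Suc N)) + (\<integral>\<^sup>+x\<in>C (Suc N). Z (Suc N) x \<partial>M) =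
       c * emeasure M (A - C N) +
         (c * emeasure M (C N - C (Suc N)) + (\<integral>\<^sup>+x\<in>C (Suc N). Z (Suc N) x \<partial>M))"
      unfolding split by (subst plus_emeasure[symmetric]) (auto simp: distrib_left add.assoc)
    also have "c * emeasure M (C N - C (Suc N)) + (\<integral>\<^sup>+x\<in>C (Suc N). Z (Suc N) x \<partial>M) =
        (\<integral>\<^sup>+x. c * indicator (C N - C (Suc N)) x + Z (Suc N) x * indicator (C (Suc N)) x \<partial>M)"
      by (subst nn_integral_add) (auto simp: nn_integral_cmult_indicator)
    \<comment> \<open>A path that leaves \<open>C N\<close> at time \<open>Suc N\<close> does so
      because \<open>Z (Suc N)\<close> is at least \<open>c\<close> there, so charging it only
      \<open>c\<close> loses mass.\<close>
    also have "\<dots> \<le> (\<integral>\<^sup>+x\<in>C N. Z (Suc N) x \<partial>M)"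
      using sub by (intro nn_integral_mono) (auto simp: C_def indicator_def le_Suc_eq)
    also have "\<dots> \<le> (\<integral>\<^sup>+x\<in>C N. Z N x \<partial>M)"
      by (rule super[OF CG])
    finally show ?case
      using Suc by (meson add_left_mono order_trans)
  qed
  then have le: "c * emeasure M (A - C N) \<le> (\<integral>\<^sup>+x\<in>A. Z 0 x \<partial>M)" for N
    by (meson add_increasing2 order_refl order_trans zero_le)
  \<comment> \<open>Continuity from below passes from a finite horizon to the event of ever
    crossing.\<close>
  have "{x \<in> A. \<exists>s. c \<le> Z s x} = (\<Union>N. A - C N)"
    by (auto simp: C_def not_less) (use not_less in blast)
  moreover have "incseq (\<lambda>N. A - C N)"
    by (auto simp: incseq_def C_def)
  ultimately have "emeasure M {x \<in> A. \<exists>s. c \<le> Z s x} = (SUP N. emeasure M (A - C N))"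
    by (simp add: SUP_emeasure_incseq image_subset_iff)
  then show ?thesis
    using le by (auto simp: SUP_mult_left_ennreal intro!: SUP_least)
qed

section \<open>Waiting times and stage times\<close>

text \<open>A finite bound excludes the empty set, whose infimum is \<infinity>, and by
  well-ordering a nonempty set attains its infimum. Bounds on waiting times thus become finite
  searches over times, which is what measurability needs.\<close>

lemma Inf_enat_image_le_iff: "Inf (enat ` A) \<le> enat i \<longleftrightarrow> (\<exists>s\<in>A. s \<le> i)"
proof
  assume *: "Inf (enat ` A) \<le> enat i"
  then have "enat ` A \<noteq> {}"
    by (auto simp: top_enat_def)
  then have "Inf (enat ` A) \<in> enat ` A"
    by (auto simp: Inf_enat_def intro: LeastI)
  with * show "\<exists>s\<in>A. s \<le> i"
    by auto
qed (metis Inf_lower enat_ord_simps(1) image_eqI order_trans)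

lemma sigma_time_le_iff:
  "sigma_time \<Gamma> b (enat k) \<omega> \<le> enat i \<longleftrightarrow> (\<exists>s\<le>i. ennreal b \<le> \<Gamma> (k + s) \<omega>)"
  by (auto simp: sigma_time_def Inf_enat_image_le_iff)

lemma tau_time_le_iff:
  "tau_time \<Lambda> d (enat k) \<omega> \<le> enat i \<longleftrightarrow>
     (\<exists>s\<le>i. 1 \<le> s \<and> (\<Prod>j=1..s. \<Lambda> (k + j) \<omega>) \<le> ennreal (1 / d))"
  by (auto simp: tau_time_def Inf_enat_image_le_iff)

lemma enat_add_le_iff: "s + w \<le> enat k \<longleftrightarrow> (\<exists>j\<le>k. s = enat j \<and> w \<le> enat (k - j))"
  by (cases s; cases w) auto

text \<open>By induction: stage \<open>Suc n\<close> is over by time \<open>k\<close> if and only if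
  stage \<open>n\<close> ended at some \<open>j\<close> with \<open>j \<le> k\<close> and the wait
  started at \<open>j\<close> is at most \<open>k - j\<close>. Such a wait reads the processes only
  up to time \<open>k\<close>. The products in \<open>tau_time\<close> start at index 1, so
  \<open>\<Lambda> 0\<close> is never read.\<close>

lemma stopping_time_obs_stage_time:
  assumes \<Gamma>: "\<And>t. \<Gamma> t \<in> borel_measurable (obs M X Y (enat t))"
    and \<Lambda>: "\<And>t. 1 \<le> t \<Longrightarrow> \<Lambda> t \<in> borel_measurable (obs M X Y (enat t))"
  shows "stopping_time (obs M X Y) (stage_time \<Gamma> \<Lambda> b1 b2 d n)"
proof (induction n)
  case 0
  show ?case
    by (simp add: stopping_time_def)
next
  case (Suc n)
  interpret filtration "space M" "obs M X Y"
    by (rule filtration_obs)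
  let ?S = "stage_time \<Gamma> \<Lambda> b1 b2 d"
  have up: "h \<in> borel_measurable (obs M X Y j)"
    if "h \<in> borel_measurable (obs M X Y i)" "i \<le> j" for h :: "_ \<Rightarrow> ennreal" and i j
    using that sets_F_mono[of i j] by (auto simp: measurable_def space_F)
  have wait: "Measurable.pred (obs M X Y (enat k)) (\<lambda>\<omega>. sigma_time \<Gamma> b (enat j) \<omega> \<le> enat (k - j))"
    "Measurable.pred (obs M X Y (enat k)) (\<lambda>\<omega>. tau_time \<Lambda> d (enat j) \<omega> \<le> enat (k - j))"
    if "j \<le> k" for b j k
  proof -
    have [measurable]: "\<Gamma> (j + s) \<in> borel_measurable (obs M X Y (enat k))" if "s \<le> k - j" for s
      using \<open>j \<le> k\<close> that by (intro up[OF \<Gamma>]) auto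
    have "(\<lambda>\<omega>. \<Prod>i=1..s. \<Lambda> (j + i) \<omega>) \<in> borel_measurable (obs M X Y (enat k))" if "s \<le> k - j" for s
      using \<open>j \<le> k\<close> that by (intro borel_measurable_prod_ennreal up[OF \<Lambda>]) auto
    note [measurable] = this
    show "Measurable.pred (obs M X Y (enat k)) (\<lambda>\<omega>. sigma_time \<Gamma> b (enat j) \<omega> \<le> enat (k - j))"
      unfolding sigma_time_le_iff by measurable
    show "Measurable.pred (obs M X Y (enat k)) (\<lambda>\<omega>. tau_time \<Lambda> d (enat j) \<omega> \<le> enat (k - j))"
      unfolding tau_time_le_iff by measurable
  qed
  show ?case
  proof
    fix t
    show "Measurable.pred (obs M X Y t) (\<lambda>\<omega>. ?S (Suc n) \<omega> \<le> t)"
    proof (cases t)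
      case (enat k)
      have eq: "?S (Suc n) \<omega> \<le> enat k \<longleftrightarrow> (\<exists>j\<le>k. ?S n \<omega> = enat j \<and>
         (if even n then sigma_time \<Gamma> b1 (enat j) \<omega> \<le> enat (k - j)
          else sigma_time \<Gamma> b2 (enat j) \<omega> \<le> enat (k - j) \<or> tau_time \<Lambda> d (enat j) \<omega> \<le> enat (k - j)))" for \<omega>
        by (auto simp: Let_def enat_add_le_iff min_le_iff_disj)
      have [measurable]: "Measurable.pred (obs M X Y (enat k)) (\<lambda>\<omega>. ?S n \<omega> = enat j)" if "j \<le> k" for j
        using stopping_time_eq_const[OF Suc, of "enat j"] sets_F_mono[of "enat j" "enat k"] that
        by (auto simp: pred_def space_F)
      note [measurable] = wait
      show ?thesis
        unfolding enat eq by (cases "even n") (simp_all, measurable)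
    qed simp
  qed
qed

section \<open>Auxiliary facts on conditional probabilities, generated sigma-algebras and
  \<open>ennreal\<close>\<close>

text \<open>\<open>real_cond_exp\<close> is built with \<open>enn2real\<close>, which sends
  \<infinity> to 0; the two versions agree once the nonnegative one is finite, and monotonicity
  bounds it by 1. This links the real-valued model assumption on responses to nonnegative
  integrals.\<close>

lemma (in finite_measure_subalgebra) AE_nn_cond_exp_indicator:
  assumes [measurable]: "A \<in> sets M"
  shows "AE x in M. nn_cond_exp M F (indicator A) x = ennreal (real_cond_exp M F (indicator A) x)"
proof -
  have le1: "AE x in M. nn_cond_exp M F (indicator A) x \<le> nn_cond_exp M F (\<lambda>_. 1) x"
    by (rule nn_cond_exp_mono) (auto simp: indicator_def)
  have one: "AE x in M. nn_cond_exp M F (\<lambda>_. 1) x = 1"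
    using nn_cond_exp_F_meas[of "\<lambda>_. 1"] by auto
  have zero: "AE x in M. nn_cond_exp M F (\<lambda>_. 0) x = 0"
    using nn_cond_exp_F_meas[of "\<lambda>_. 0"] by auto
  have "(\<lambda>x. ennreal (indicator A x)) = indicator A" "(\<lambda>x. ennreal (- indicator A x)) = (\<lambda>_. 0)"
    by (auto simp: indicator_def fun_eq_iff ennreal_neg)
  note eq = this
  show ?thesis
    using le1 one zero unfolding real_cond_exp_def eq
    by eventually_elim (auto simp: ennreal_enn2real_if top_unique)
qed

lemma measurable_sigma_generator:
  assumes "f \<in> space M \<rightarrow> space N" "sets (vimage_algebra (space M) f N) \<subseteq> G" "G \<subseteq> Pow (space M)"
  shows "f \<in> sigma (space M) G \<rightarrow>\<^sub>M N"
proof (rule measurableI)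
  fix A assume "A \<in> sets N"
  then have "f -` A \<inter> space M \<in> G"
    using assms(2) in_vimage_algebra by blast
  then show "f -` A \<inter> space (sigma (space M) G) \<in> sets (sigma (space M) G)"
    using assms(3) by (simp add: space_measure_of)
qed (use assms in \<open>auto simp: space_measure_of\<close>)

lemma sets_vimage_algebra_subset:
  assumes "f \<in> M \<rightarrow>\<^sub>M N"
  shows "sets (vimage_algebra (space M) f N) \<subseteq> sets M"
  using assms by (subst sets_vimage_algebra2) (auto simp: measurable_def)

lemma subalgebra_sigma: "G \<subseteq> sets M \<Longrightarrow> subalgebra M (sigma (space M) G)"
  using sets.space_closed[of M]
  by (simp add: subalgebra_def space_measure_of_conv sets.sigma_sets_subset sets_measure_of_conv)

lemma latent_mono: "latent \<Theta> k \<omega> = 1 \<Longrightarrow> k \<le> t \<Longrightarrow> latent \<Theta> t \<omega> = 1"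
  by (cases "\<Theta> \<omega>") (auto simp: latent_def split: if_splits)

lemma ennreal_inverse_antimono: "a \<le> b \<Longrightarrow> inverse b \<le> inverse (a :: ennreal)"
  including ennreal.lifting by transfer (simp add: ereal_inverse_antimono)

text \<open>Positivity excludes the product of 0 and \<infinity>, where the rule breaks: the inverse
  of that product is \<infinity>, while the product of the inverses is 0. Infinite factors alone do
  no harm.\<close>

lemma ennreal_inverse_prod:
  fixes h :: "'i \<Rightarrow> ennreal"
  assumes "\<And>i. i \<in> I \<Longrightarrow> 0 < h i"
  shows "inverse (\<Prod>i\<in>I. h i) = (\<Prod>i\<in>I. inverse (h i))"
  using assms
proof (induction I rule: infinite_finite_induct)
  case (insert i I)
  then have "0 < (\<Prod>i\<in>I. h i)" "0 < h i"
    by (auto simp: zero_less_iff_neq_zero)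
  then show ?case
    using insert by (simp add: ennreal_inverse_mult')
qed auto

section \<open>Measurability in the change-point model\<close>

context change_point_model
begin

lemma X_range: "1 \<le> t \<Longrightarrow> \<omega> \<in> space M \<Longrightarrow> X t \<omega> \<in> {1..K}"
  using assignment by (auto simp: assignment_rule_def)

text \<open>The model states measurability of responses and of the change time; for treatments it
  follows by strong induction, each being a measurable function of the earlier treatments and
  responses.\<close>

lemma X_measurable: "1 \<le> t \<Longrightarrow> X t \<in> M \<rightarrow>\<^sub>M count_space UNIV"
proof (induction t rule: less_induct)
  case (less t)
  show ?case
  proof (cases "t = 1")
    case True
    then obtain x where "\<forall>\<omega>\<in>space M. X t \<omega> = x"
      using assignment by (auto simp: assignment_rule_def)
    then show ?thesis
      by (subst measurable_cong[of _ _ "\<lambda>_. x"]) auto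
  next
    case False
    then have "2 \<le> t"
      using less by simp
    then obtain h where h: "h \<in> (\<Pi>\<^sub>M s\<in>{1..<t}. count_space UNIV \<Otimes>\<^sub>M borel) \<rightarrow>\<^sub>M count_space UNIV"
      and eq: "\<forall>\<omega>\<in>space M. X t \<omega> = h (\<lambda>s\<in>{1..<t}. (X s \<omega>, Y s \<omega>))"
      using assignment unfolding assignment_rule_def by blast
    have "(\<lambda>\<omega>. \<lambda>s\<in>{1..<t}. (X s \<omega>, Y s \<omega>)) \<in> M \<rightarrow>\<^sub>M (\<Pi>\<^sub>M s\<in>{1..<t}. count_space UNIV \<Otimes>\<^sub>M borel)"
      using less Y_measurable by (intro measurable_restrict measurable_Pair) auto
    from measurable_compose[OF this h] show ?thesis
      using eq by (subst measurable_cong) auto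
  qed
qed

lemma latent_measurable: "latent \<Theta> t \<in> M \<rightarrow>\<^sub>M count_space UNIV"
  unfolding latent_def
  by (rule measurable_compose[OF \<Theta>_measurable]) simp

lemma subalgebra_obs: "subalgebra M (obs M X Y t)"
  unfolding obs_def
  by (intro subalgebra_sigma UN_least Un_least sets_vimage_algebra_subset)
     (auto intro: X_measurable Y_measurable)

lemma obs_generators_closed:
  "(\<Union>s\<in>I. sets (vimage_algebra (space M) (X s) (count_space UNIV)) \<union>
     sets (vimage_algebra (space M) (Y s) borel)) \<subseteq> Pow (space M)"
  by (auto simp: sets_vimage_algebra2)

lemma XY_measurable_obs:
  assumes "1 \<le> s" "enat s \<le> t"
  shows "X s \<in> obs M X Y t \<rightarrow>\<^sub>M count_space UNIV" "Y s \<in> obs M X Y t \<rightarrow>\<^sub>M borel"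
  unfolding obs_def using assms
  by (intro measurable_sigma_generator obs_generators_closed; auto)+

lemma obs_latent_generators:
  assumes "1 \<le> t"
  shows "sets (obs M X Y (enat (t - 1))) \<union>
      sets (vimage_algebra (space M) (X t) (count_space UNIV)) \<union>
      (\<Union>s\<in>I. sets (vimage_algebra (space M) (latent \<Theta> s) (count_space UNIV))) \<subseteq> sets M"
  using assms subalgebra_obs
  by (intro UN_least Un_least sets_vimage_algebra_subset)
     (auto intro: X_measurable latent_measurable simp: subalgebra_def)

lemma subalgebra_obs_latent: "1 \<le> t \<Longrightarrow> subalgebra M (obs_latent M X Y \<Theta> t I)"
  unfolding obs_latent_def by (intro subalgebra_sigma obs_latent_generators)

lemma space_obs_latent: "space (obs_latent M X Y \<Theta> t I) = space M"
  unfolding obs_latent_def by (simp add: space_measure_of_conv)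

lemma
  assumes "1 \<le> t"
  shows sets_obs_subset_obs_latent: "sets (obs M X Y (enat (t - 1))) \<subseteq> sets (obs_latent M X Y \<Theta> t I)"
    and X_measurable_obs_latent: "X t \<in> obs_latent M X Y \<Theta> t I \<rightarrow>\<^sub>M count_space UNIV"
    and latent_measurable_obs_latent:
      "s \<in> I \<Longrightarrow> latent \<Theta> s \<in> obs_latent M X Y \<Theta> t I \<rightarrow>\<^sub>M count_space UNIV"
proof -
  note closed = subset_trans[OF obs_latent_generators[OF assms] sets.space_closed]
  show "sets (obs M X Y (enat (t - 1))) \<subseteq> sets (obs_latent M X Y \<Theta> t I)"
    unfolding obs_latent_def by (subst sets_measure_of[OF closed]) auto
  show "X t \<in> obs_latent M X Y \<Theta> t I \<rightarrow>\<^sub>M count_space UNIV"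
    unfolding obs_latent_def by (intro measurable_sigma_generator closed) auto
  show "latent \<Theta> s \<in> obs_latent M X Y \<Theta> t I \<rightarrow>\<^sub>M count_space UNIV" if "s \<in> I"
    unfolding obs_latent_def using that by (intro measurable_sigma_generator closed) auto
qed

text \<open>The treatment at time \<open>t\<close> belongs to the observations up to
  \<open>t\<close>, which the next sigma-algebra contains. Hence these enlarged sigma-algebras
  increase and can carry the supermartingale.\<close>

lemma sets_obs_latent_mono:
  assumes "1 \<le> t"
  shows "sets (obs_latent M X Y \<Theta> t {0..t}) \<subseteq> sets (obs_latent M X Y \<Theta> (Suc t) {0..Suc t})"
    (is "_ \<subseteq> sets ?G")
proof -
  interpret filtration "space M" "obs M X Y"
    by (rule filtration_obs)
  have obs: "sets (obs M X Y (enat t)) \<subseteq> sets ?G"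
    using sets_obs_subset_obs_latent[of "Suc t"] by simp
  moreover have "sets (obs M X Y (enat (t - 1))) \<subseteq> sets (obs M X Y (enat t))"
    by (rule sets_F_mono) simp
  moreover have "X t \<in> ?G \<rightarrow>\<^sub>M count_space UNIV"
    using XY_measurable_obs(1)[OF assms order_refl] obs
    by (auto simp: measurable_def space_F space_obs_latent)
  from sets_vimage_algebra_subset[OF this]
  have "sets (vimage_algebra (space M) (X t) (count_space UNIV)) \<subseteq> sets ?G"
    by (simp add: space_obs_latent)
  moreover have "sets (vimage_algebra (space M) (latent \<Theta> s) (count_space UNIV)) \<subseteq> sets ?G"
    if "s \<in> {0..t}" for s
    using sets_vimage_algebra_subset[OF latent_measurable_obs_latent[of "Suc t" s "{0..Suc t}"]] that
    by (simp add: space_obs_latent)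
  ultimately have "sigma_sets (space M) (sets (obs M X Y (enat (t - 1))) \<union>
      sets (vimage_algebra (space M) (X t) (count_space UNIV)) \<union>
      (\<Union>s\<in>{0..t}. sets (vimage_algebra (space M) (latent \<Theta> s) (count_space UNIV)))) \<subseteq> sets ?G"
    by (intro sets.sigma_sets_subset[of _ ?G, unfolded space_obs_latent] Un_least UN_least) auto
  then show ?thesis
    unfolding obs_latent_def[of _ _ _ _ t]
    by (subst sets_measure_of[OF subset_trans[OF obs_latent_generators[OF assms] sets.space_closed]])
qed

lemma lik_ratio_measurable:
  assumes "1 \<le> t"
  shows "lik_ratio f g X Y t \<in> borel_measurable (obs M X Y (enat t))"
proof -
  interpret filtration "space M" "obs M X Y"
    by (rule filtration_obs)
  \<comment> \<open>The densities are known to be measurable only for treatments in range. The value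
    0 elsewhere never shows, since \<open>X t\<close> stays in range, and the countably many values
    of \<open>X t\<close> can be handled one at a time.\<close>
  let ?h = "\<lambda>x \<omega>. if x \<in> {1..K} then ennreal (g x (Y t \<omega>)) / ennreal (f x (Y t \<omega>)) else 0"
  have "?h x \<in> borel_measurable (obs M X Y (enat t))" for x
  proof (cases "x \<in> {1..K}")
    case True
    then have "f x \<in> borel_measurable borel" "g x \<in> borel_measurable borel"
      using f_density[of x] g_density[of x] measurable_cong_sets[OF sets_mu refl] by auto
    note [measurable] = this XY_measurable_obs(2)[OF assms order_refl]
    show ?thesis
      by measurable
  qed auto
  from measurable_compose_countable[OF this XY_measurable_obs(1)[OF assms order_refl]]
  show ?thesis
    using X_range[OF assms]
    by (subst measurable_cong[where g = "\<lambda>\<omega>. ?h (X t \<omega>) \<omega>"]) (auto simp: lik_ratio_def space_F)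
qed

section \<open>Likelihood ratios after the change\<close>

text \<open>\<open>D\<close> is an event of the conditioning sigma-algebra on which the conditional
  density of \<open>Y t\<close> is \<open>g x\<close>. So the response is integrated out against
  \<open>g x\<close>, while the weight \<open>H\<close>, known before the response, factors
  out.\<close>

lemma nn_integral_post_change:
  assumes t: "1 \<le> t" and x: "x \<in> {1..K}"
    and H: "H \<in> borel_measurable (obs_latent M X Y \<Theta> t {0..t})"
    and \<phi>[measurable]: "\<phi> \<in> borel_measurable borel"
  defines "D \<equiv> {\<omega> \<in> space M. X t \<omega> = x \<and> latent \<Theta> t \<omega> = 1}"
  shows "(\<integral>\<^sup>+\<omega>\<in>D. H \<omega> * \<phi> (Y t \<omega>) \<partial>M) = (\<integral>\<^sup>+\<omega>\<in>D. H \<omega> \<partial>M) * (\<integral>\<^sup>+y. ennreal (g x y) * \<phi> y \<partial>\<mu>)"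
proof -
  let ?G = "obs_latent M X Y \<Theta> t {0..t}"
  interpret G: finite_measure_subalgebra M ?G
    by (unfold_locales) (rule subalgebra_obs_latent[OF t])
  note [measurable_cong] = sets_mu
  have [measurable]: "Y t \<in> borel_measurable M" "g x \<in> borel_measurable borel"
    using Y_measurable[OF t] g_density[OF x] measurable_cong_sets[OF sets_mu refl] by auto
  define W where "W \<omega> = H \<omega> * indicator D \<omega>" for \<omega>
  define c where "c = (\<integral>\<^sup>+\<omega>. W \<omega> \<partial>M)"
  have "D \<in> sets ?G"
  proof -
    note [measurable] = X_measurable_obs_latent[OF t, of "{0..t}"]
      latent_measurable_obs_latent[OF t, of t "{0..t}"]
    have "{\<omega> \<in> space ?G. X t \<omega> = x \<and> latent \<Theta> t \<omega> = 1} \<in> sets ?G"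
      by measurable
    then show ?thesis
      by (simp add: D_def space_obs_latent)
  qed
  with H have WG: "W \<in> borel_measurable ?G"
    unfolding W_def by measurable
  then have [measurable]: "W \<in> borel_measurable M"
    by (rule measurable_from_subalg[OF G.subalg])
  \<comment> \<open>Equality of the two measures only has to be tested on Borel sets, where
    \<open>response\<close> applies; integrating \<open>\<phi>\<close> against both then gives the
    claim for general \<open>\<phi>\<close>.\<close>
  have "distr (density M W) borel (Y t) = density \<mu> (\<lambda>y. c * ennreal (g x y))"
  proof (rule measure_eqI)
    fix A assume "A \<in> sets (distr (density M W) borel (Y t))"
    then have A[measurable]: "A \<in> sets borel"
      by simp
    let ?B = "{\<omega> \<in> space M. Y t \<omega> \<in> A}"
    have B: "?B \<in> sets M"
      by measurable
    have [measurable]: "A \<in> sets \<mu>"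
      by (simp add: sets_mu)
    \<comment> \<open>\<open>response\<close> uses a Bochner integral. It agrees with the
      nonnegative one because \<open>g x\<close> is a density, hence integrable.\<close>
    have gA: "ennreal (LINT y:A|\<mu>. g x y) = (\<integral>\<^sup>+y\<in>A. ennreal (g x y) \<partial>\<mu>)"
    proof -
      have "integrable \<mu> (g x)"
        using g_density[OF x] by (intro integrableI_nonneg) auto
      then have "integrable \<mu> (\<lambda>y. indicator A y *\<^sub>R g x y)"
        by (intro integrable_mult_indicator) auto
      then show ?thesis
        unfolding set_lebesgue_integral_def using g_density[OF x]
        by (subst nn_integral_eq_integral[symmetric])
           (auto intro!: nn_integral_cong simp: indicator_def)
    qed
    have "AE \<omega> in M. W \<omega> * nn_cond_exp M ?G (indicator ?B) \<omega> = W \<omega> * (\<integral>\<^sup>+y\<in>A. ennreal (g x y) \<partial>\<mu>)"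
      using G.AE_nn_cond_exp_indicator[OF B] response[OF t A, unfolded cprob_def]
    proof eventually_elim
      fix \<omega> assume "nn_cond_exp M ?G (indicator ?B) \<omega> = ennreal (real_cond_exp M ?G (indicator ?B) \<omega>)"
        "real_cond_exp M ?G (indicator ?B) \<omega> =
          (LINT y:A|\<mu>. if latent \<Theta> t \<omega> = 0 then f (X t \<omega>) y else g (X t \<omega>) y)"
      then show "W \<omega> * nn_cond_exp M ?G (indicator ?B) \<omega> = W \<omega> * (\<integral>\<^sup>+y\<in>A. ennreal (g x y) \<partial>\<mu>)"
        by (auto simp: W_def D_def gA indicator_def)
    qed
    have "emeasure (distr (density M W) borel (Y t)) A = (\<integral>\<^sup>+\<omega>. W \<omega> * indicator ?B \<omega> \<partial>M)"
      by (auto simp: emeasure_distr emeasure_density indicator_def intro!: nn_integral_cong)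
    also have "\<dots> = (\<integral>\<^sup>+\<omega>. W \<omega> * nn_cond_exp M ?G (indicator ?B) \<omega> \<partial>M)"
      by (rule G.nn_cond_exp_intg[OF WG, symmetric]) measurable
    also have "\<dots> = (\<integral>\<^sup>+\<omega>. W \<omega> * (\<integral>\<^sup>+y\<in>A. ennreal (g x y) \<partial>\<mu>) \<partial>M)"
      by (rule nn_integral_cong_AE) fact
    also have "\<dots> = c * (\<integral>\<^sup>+y\<in>A. ennreal (g x y) \<partial>\<mu>)"
      unfolding c_def by (rule nn_integral_multc) measurable
    also have "\<dots> = emeasure (density \<mu> (\<lambda>y. c * ennreal (g x y))) A"
      by (simp add: emeasure_density nn_integral_cmult[symmetric] mult.assoc)
    finally show "emeasure (distr (density M W) borel (Y t)) A = \<dots>" .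
  qed (simp add: sets_mu)
  then have "(\<integral>\<^sup>+y. \<phi> y \<partial>distr (density M W) borel (Y t)) = (\<integral>\<^sup>+y. \<phi> y \<partial>density \<mu> (\<lambda>y. c * ennreal (g x y)))"
    by simp
  then have "(\<integral>\<^sup>+\<omega>. W \<omega> * \<phi> (Y t \<omega>) \<partial>M) = c * (\<integral>\<^sup>+y. ennreal (g x y) * \<phi> y \<partial>\<mu>)"
    by (simp add: nn_integral_distr nn_integral_density mult.assoc nn_integral_cmult)
  then show ?thesis
    by (simp add: W_def c_def mult_ac)
qed

text \<open>Under \<open>g x\<close> the mean of \<open>f x / g x\<close> is the mass that
  \<open>f x\<close> gives to the set where \<open>g x\<close> is positive, hence at most 1. It may
  be smaller than 1, so the inverse products form a supermartingale and not necessarily a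
  martingale. Splitting by the chosen treatment reduces the claim to fixed \<open>x\<close>.\<close>

lemma nn_integral_post_change_inverse_lik_ratio_le:
  assumes t: "1 \<le> t" and H: "H \<in> borel_measurable (obs_latent M X Y \<Theta> t {0..t})"
  defines "L \<equiv> {\<omega> \<in> space M. latent \<Theta> t \<omega> = 1}"
  shows "(\<integral>\<^sup>+\<omega>\<in>L. H \<omega> * inverse (lik_ratio f g X Y t \<omega>) \<partial>M) \<le> (\<integral>\<^sup>+\<omega>\<in>L. H \<omega> \<partial>M)"
proof -
  define D where "D x = {\<omega> \<in> space M. X t \<omega> = x \<and> latent \<Theta> t \<omega> = 1}" for x
  define \<phi> where "\<phi> x y = inverse (ennreal (g x y) / ennreal (f x y))" for x y
  note [measurable] = X_measurable[OF t] Y_measurable[OF t] latent_measurable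
    measurable_from_subalg[OF subalgebra_obs_latent[OF t] H]
  have [measurable]: "D x \<in> sets M" for x
    unfolding D_def by measurable
  have fg: "f x \<in> borel_measurable borel" "g x \<in> borel_measurable borel" if "x \<in> {1..K}" for x
    using f_density[OF that] g_density[OF that] measurable_cong_sets[OF sets_mu refl] by auto
  have \<phi>: "\<phi> x \<in> borel_measurable borel" if "x \<in> {1..K}" for x
    unfolding \<phi>_def using fg[OF that] by measurable
  have \<phi>Y: "(\<lambda>\<omega>. \<phi> x (Y t \<omega>)) \<in> borel_measurable M" if "x \<in> {1..K}" for x
    by (rule measurable_compose[OF Y_measurable[OF t] \<phi>[OF that]])
  have indicator_L: "indicator L \<omega> = (\<Sum>x\<in>{1..K}. indicator (D x) \<omega> :: ennreal)" if "\<omega> \<in> space M" for \<omega>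
  proof -
    have "(\<Sum>x\<in>{1..K}. indicator (D x) \<omega> :: ennreal) = (\<Sum>x\<in>{1..K}. if x = X t \<omega> then indicator L \<omega> else 0)"
      using that by (intro sum.cong) (auto simp: D_def L_def indicator_def)
    then show ?thesis
      using X_range[OF t that] by simp
  qed
  have "(\<integral>\<^sup>+\<omega>\<in>L. H \<omega> * inverse (lik_ratio f g X Y t \<omega>) \<partial>M) =
      (\<integral>\<^sup>+\<omega>. (\<Sum>x\<in>{1..K}. H \<omega> * \<phi> x (Y t \<omega>) * indicator (D x) \<omega>) \<partial>M)"
  proof (intro nn_integral_cong)
    fix \<omega> assume "\<omega> \<in> space M"
    then have "H \<omega> * inverse (lik_ratio f g X Y t \<omega>) * indicator L \<omega> =
        (\<Sum>x\<in>{1..K}. H \<omega> * inverse (lik_ratio f g X Y t \<omega>) * indicator (D x) \<omega>)"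
      by (simp add: indicator_L sum_distrib_left)
    also have "\<dots> = (\<Sum>x\<in>{1..K}. H \<omega> * \<phi> x (Y t \<omega>) * indicator (D x) \<omega>)"
      by (intro sum.cong) (auto simp: D_def \<phi>_def lik_ratio_def indicator_def)
    finally show "H \<omega> * inverse (lik_ratio f g X Y t \<omega>) * indicator L \<omega> = \<dots>" .
  qed
  also have "\<dots> = (\<Sum>x\<in>{1..K}. \<integral>\<^sup>+\<omega>\<in>D x. H \<omega> * \<phi> x (Y t \<omega>) \<partial>M)"
    using \<phi>Y by (intro nn_integral_sum) simp
  also have "\<dots> \<le> (\<Sum>x\<in>{1..K}. \<integral>\<^sup>+\<omega>\<in>D x. H \<omega> \<partial>M)"
  proof (intro sum_mono)
    fix x assume x: "x \<in> {1..K}"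
    \<comment> \<open>The \<open>ennreal\<close> conventions cover the zeros: the left side is 0 if
      \<open>g x y = 0\<close>, and \<open>\<phi> x y = 0\<close> if
      \<open>f x y = 0 < g x y\<close>.\<close>
    have "ennreal (g x y) * \<phi> x y \<le> ennreal (f x y)" for y
    proof (cases "g x y = 0 \<or> f x y = 0")
      case False
      then have "0 < g x y" "0 < f x y"
        using f_density[OF x] g_density[OF x] by (auto simp: less_le)
      then show ?thesis
        by (simp add: \<phi>_def divide_ennreal inverse_ennreal ennreal_mult[symmetric])
    qed (use f_density[OF x] g_density[OF x] in \<open>auto simp: \<phi>_def\<close>)
    then have "(\<integral>\<^sup>+y. ennreal (g x y) * \<phi> x y \<partial>\<mu>) \<le> (\<integral>\<^sup>+y. ennreal (f x y) \<partial>\<mu>)"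
      by (rule nn_integral_mono)
    then have le1: "(\<integral>\<^sup>+y. ennreal (g x y) * \<phi> x y \<partial>\<mu>) \<le> 1"
      using f_density[OF x] by simp
    show "(\<integral>\<^sup>+\<omega>\<in>D x. H \<omega> * \<phi> x (Y t \<omega>) \<partial>M) \<le> (\<integral>\<^sup>+\<omega>\<in>D x. H \<omega> \<partial>M)"
      unfolding D_def nn_integral_post_change[OF t x H \<phi>[OF x]]
      using mult_left_mono[OF le1] by simp
  qed
  also have "\<dots> = (\<integral>\<^sup>+\<omega>. (\<Sum>x\<in>{1..K}. H \<omega> * indicator (D x) \<omega>) \<partial>M)"
    by (intro nn_integral_sum[symmetric]) simp
  also have "\<dots> = (\<integral>\<^sup>+\<omega>\<in>L. H \<omega> \<partial>M)"
    by (intro nn_integral_cong) (simp add: indicator_L sum_distrib_left)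
  finally show ?thesis .
qed

text \<open>A response drawn from \<open>g x\<close> almost surely avoids the zeros of
  \<open>g x\<close>. A zero of \<open>f x\<close> is harmless, as the ratio is then \<infinity>.
  Positivity is what lets the inverse pass through the products of ratios.\<close>

lemma AE_post_change_lik_ratio_pos:
  assumes t: "1 \<le> t"
  shows "AE \<omega> in M. latent \<Theta> t \<omega> = 1 \<longrightarrow> 0 < lik_ratio f g X Y t \<omega>"
proof -
  have "AE \<omega> in M. X t \<omega> = x \<longrightarrow> latent \<Theta> t \<omega> = 1 \<longrightarrow> g x (Y t \<omega>) \<noteq> 0" if x: "x \<in> {1..K}" for x
  proof -
    define D where "D = {\<omega> \<in> space M. X t \<omega> = x \<and> latent \<Theta> t \<omega> = 1}"
    note [measurable] = X_measurable[OF t] Y_measurable[OF t] latent_measurable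
    have [measurable]: "D \<in> sets M"
      unfolding D_def by measurable
    have [measurable]: "g x \<in> borel_measurable borel"
      using g_density[OF x] measurable_cong_sets[OF sets_mu refl] by auto
    have "(\<integral>\<^sup>+\<omega>\<in>D. 1 * indicator {y. g x y = 0} (Y t \<omega>) \<partial>M) =
        (\<integral>\<^sup>+\<omega>\<in>D. 1 \<partial>M) * (\<integral>\<^sup>+y. ennreal (g x y) * indicator {y. g x y = 0} y \<partial>\<mu>)"
      unfolding D_def by (rule nn_integral_post_change[OF t x]) measurable
    also have "(\<lambda>y. ennreal (g x y) * indicator {y. g x y = 0} y) = (\<lambda>_. 0)"
      by (auto simp: indicator_def fun_eq_iff)
    finally have "(\<integral>\<^sup>+\<omega>\<in>D. indicator {y. g x y = 0} (Y t \<omega>) \<partial>M) = 0"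
      by simp
    then have "AE \<omega> in M. indicator {y. g x y = 0} (Y t \<omega>) * indicator D \<omega> = (0 :: ennreal)"
      by (subst (asm) nn_integral_0_iff_AE) measurable
    then show ?thesis
      using AE_space by eventually_elim (auto simp: D_def indicator_def split: if_splits)
  qed
  then have "AE \<omega> in M. \<forall>x\<in>{1..K}. X t \<omega> = x \<longrightarrow> latent \<Theta> t \<omega> = 1 \<longrightarrow> g x (Y t \<omega>) \<noteq> 0"
    by (intro AE_finite_allI) auto
  then show ?thesis
    using AE_space
  proof eventually_elim
    case (elim \<omega>)
    then have "latent \<Theta> t \<omega> = 1 \<longrightarrow> 0 < g (X t \<omega>) (Y t \<omega>)"
      using X_range[OF t, of \<omega>] g_density[of "X t \<omega>"] by (auto simp: less_le)
    then show ?case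
      by (auto simp: lik_ratio_def ennreal_zero_less_divide)
  qed
qed

text \<open>A product of ratios falling to \<open>1 / d\<close> means that its inverse rises to
  \<open>d\<close>. After the change the inverse products form a nonnegative supermartingale started
  at 1, so the maximal inequality on \<open>E\<close> applies.\<close>

lemma post_change_lik_ratio_maximal:
  assumes E: "E \<in> sets (obs M X Y (enat k))" and d: "0 < d"
  shows "d * prob {\<omega> \<in> E. latent \<Theta> k \<omega> = 1 \<and>
      (\<exists>s. (\<Prod>j=1..s. lik_ratio f g X Y (k + j) \<omega>) \<le> ennreal (1 / d))}
    \<le> prob {\<omega> \<in> E. latent \<Theta> k \<omega> = 1}"
proof -
  interpret filtration "space M" "obs M X Y"
    by (rule filtration_obs)
  let ?\<Lambda> = "lik_ratio f g X Y"
  define L where "L = {\<omega> \<in> space M. latent \<Theta> k \<omega> = 1}"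
  define P where "P s \<omega> = (\<Prod>j=1..s. inverse (?\<Lambda> (k + j) \<omega>))" for s \<omega>
  define Z where "Z s \<omega> = indicator L \<omega> * P s \<omega>" for s \<omega>
  \<comment> \<open>The index is shifted by one: \<open>G s\<close> contains everything known just
    before the response at time \<open>k + s + 1\<close>, including its treatment and latent state,
    so the one-step bound at that time can be tested on \<open>G s\<close>.\<close>
  define G where "G s = obs_latent M X Y \<Theta> (Suc (k + s)) {0..Suc (k + s)}" for s
  have EM: "E \<in> sets M" "E \<subseteq> space M"
    using E subalgebra_obs sets.sets_into_space[OF E] by (auto simp: subalgebra_def space_F)
  have sub: "subalgebra M (G s)" for s
    unfolding G_def by (rule subalgebra_obs_latent) simp
  have obs_G: "sets (obs M X Y (enat (k + s))) \<subseteq> sets (G s)" for s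
    using sets_obs_subset_obs_latent[of "Suc (k + s)"] by (simp add: G_def)
  have LG[measurable]: "L \<in> sets (G s)" for s
  proof -
    have [measurable]: "latent \<Theta> k \<in> G s \<rightarrow>\<^sub>M count_space UNIV"
      unfolding G_def by (rule latent_measurable_obs_latent) auto
    have "{\<omega> \<in> space (G s). latent \<Theta> k \<omega> = 1} \<in> sets (G s)"
      by measurable
    then show ?thesis
      by (simp add: L_def G_def space_obs_latent)
  qed
  have PG: "P s \<in> borel_measurable (G s)" for s
  proof -
    have "?\<Lambda> (k + j) \<in> borel_measurable (G s)" if "j \<in> {1..s}" for j
    proof -
      have "sets (obs M X Y (enat (k + j))) \<subseteq> sets (G s)"
        using obs_G[of s] sets_F_mono[of "enat (k + j)" "enat (k + s)"] that by auto
      moreover have "?\<Lambda> (k + j) \<in> borel_measurable (obs M X Y (enat (k + j)))"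
        using that by (intro lik_ratio_measurable) simp
      ultimately show ?thesis
        by (auto simp: measurable_def space_F G_def space_obs_latent)
    qed
    then show ?thesis
      unfolding P_def by (intro borel_measurable_prod_ennreal) auto
  qed
  have ZG: "Z s \<in> borel_measurable (G s)" for s
    unfolding Z_def using PG LG by measurable
  have "(\<integral>\<^sup>+\<omega>\<in>A. Z (Suc s) \<omega> \<partial>M) \<le> (\<integral>\<^sup>+\<omega>\<in>A. Z s \<omega> \<partial>M)" if A: "A \<in> sets (G s)" for s A
  proof -
    \<comment> \<open>The test event is absorbed into the weight. \<open>H\<close> vanishes off
      \<open>L\<close>, and a change present at time \<open>k\<close> persists, so integrating over
      \<open>?L\<close> or over \<open>L\<close> makes no difference.\<close>
    define H where "H \<omega> = indicator A \<omega> * Z s \<omega>" for \<omega>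
    let ?t = "Suc (k + s)" and ?L = "{\<omega> \<in> space M. latent \<Theta> (Suc (k + s)) \<omega> = 1}"
    have LL: "L \<subseteq> ?L"
      using latent_mono[of \<Theta> k _ ?t] by (auto simp: L_def)
    have "H \<in> borel_measurable (G s)"
      unfolding H_def using A ZG by measurable
    then have "(\<integral>\<^sup>+\<omega>\<in>?L. H \<omega> * inverse (?\<Lambda> ?t \<omega>) \<partial>M) \<le> (\<integral>\<^sup>+\<omega>\<in>?L. H \<omega> \<partial>M)"
      unfolding G_def by (intro nn_integral_post_change_inverse_lik_ratio_le) simp_all
    moreover have "(\<integral>\<^sup>+\<omega>\<in>?L. H \<omega> \<partial>M) = (\<integral>\<^sup>+\<omega>\<in>A. Z s \<omega> \<partial>M)"
      using LL by (intro nn_integral_cong) (auto simp: H_def Z_def indicator_def)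
    moreover have "(\<integral>\<^sup>+\<omega>\<in>?L. H \<omega> * inverse (?\<Lambda> ?t \<omega>) \<partial>M) = (\<integral>\<^sup>+\<omega>\<in>A. Z (Suc s) \<omega> \<partial>M)"
      using LL by (intro nn_integral_cong) (auto simp: H_def Z_def P_def indicator_def)
    ultimately show ?thesis
      by simp
  qed
  moreover have "sets (G s) \<subseteq> sets (G (Suc s))" for s
    unfolding G_def using sets_obs_latent_mono[of "Suc (k + s)"] by simp
  moreover have "E \<in> sets (G 0)"
    using E obs_G[of 0] by auto
  ultimately have "ennreal d * emeasure M {\<omega> \<in> E. \<exists>s. ennreal d \<le> Z s \<omega>} \<le> (\<integral>\<^sup>+\<omega>\<in>E. Z 0 \<omega> \<partial>M)"
    by (intro nn_supermartingale_maximal[OF sub _ ZG])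
  also have "(\<integral>\<^sup>+\<omega>\<in>E. Z 0 \<omega> \<partial>M) = (\<integral>\<^sup>+\<omega>. indicator {\<omega> \<in> E. latent \<Theta> k \<omega> = 1} \<omega> \<partial>M)"
    using EM by (intro nn_integral_cong) (auto simp: Z_def P_def L_def indicator_def)
  also have "\<dots> = emeasure M {\<omega> \<in> E. latent \<Theta> k \<omega> = 1}"
  proof (rule nn_integral_indicator)
    have "{\<omega> \<in> E. latent \<Theta> k \<omega> = 1} = E \<inter> L"
      using EM by (auto simp: L_def)
    moreover have "L \<in> sets M"
      using LG[of 0] sub[of 0] unfolding subalgebra_def by blast
    ultimately show "{\<omega> \<in> E. latent \<Theta> k \<omega> = 1} \<in> sets M"
      using EM by simp
  qed
  finally have upper: "ennreal d * emeasure M {\<omega> \<in> E. \<exists>s. ennreal d \<le> Z s \<omega>} \<le>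
      emeasure M {\<omega> \<in> E. latent \<Theta> k \<omega> = 1}" .
  have "ennreal d * emeasure M
      {\<omega> \<in> E. latent \<Theta> k \<omega> = 1 \<and> (\<exists>s. (\<Prod>j=1..s. ?\<Lambda> (k + j) \<omega>) \<le> ennreal (1 / d))} \<le>
      ennreal d * emeasure M {\<omega> \<in> E. \<exists>s. ennreal d \<le> Z s \<omega>}"
  proof (intro mult_left_mono emeasure_mono_AE)
    \<comment> \<open>One null set serves all times. Off it, \<open>Z s\<close> is the inverse of
      the product of ratios, provided the change has occurred by time \<open>k\<close>.\<close>
    have "AE \<omega> in M. \<forall>t\<in>{1..}. latent \<Theta> t \<omega> = 1 \<longrightarrow> 0 < ?\<Lambda> t \<omega>"
      using AE_post_change_lik_ratio_pos by (subst AE_ball_countable) auto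
    then show "AE \<omega> in M.
        \<omega> \<in> {\<omega> \<in> E. latent \<Theta> k \<omega> = 1 \<and> (\<exists>s. (\<Prod>j=1..s. ?\<Lambda> (k + j) \<omega>) \<le> ennreal (1 / d))} \<longrightarrow>
        \<omega> \<in> {\<omega> \<in> E. \<exists>s. ennreal d \<le> Z s \<omega>}"
    proof eventually_elim
      case (elim \<omega>)
      show ?case
      proof
        assume \<omega>: "\<omega> \<in> {\<omega> \<in> E. latent \<Theta> k \<omega> = 1 \<and> (\<exists>s. (\<Prod>j=1..s. ?\<Lambda> (k + j) \<omega>) \<le> ennreal (1 / d))}"
        then obtain s where s: "(\<Prod>j=1..s. ?\<Lambda> (k + j) \<omega>) \<le> ennreal (1 / d)"
          by auto
        have "ennreal d = inverse (ennreal (1 / d))"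
          using d by (simp add: inverse_ennreal)
        also have "\<dots> \<le> inverse (\<Prod>j=1..s. ?\<Lambda> (k + j) \<omega>)"
          by (rule ennreal_inverse_antimono[OF s])
        also have "\<dots> = P s \<omega>"
          unfolding P_def using elim \<omega> latent_mono[of \<Theta> k \<omega>] by (intro ennreal_inverse_prod) auto
        also have "\<dots> = Z s \<omega>"
          using \<omega> EM by (auto simp: Z_def L_def)
        finally show "\<omega> \<in> {\<omega> \<in> E. \<exists>s. ennreal d \<le> Z s \<omega>}"
          using \<omega> by blast
      qed
    qed
    have "{\<omega> \<in> E. \<exists>s. ennreal d \<le> Z s \<omega>} = E \<inter> {\<omega> \<in> space M. \<exists>s. ennreal d \<le> Z s \<omega>}"
      using EM by auto
    moreover have [measurable]: "Z s \<in> borel_measurable M" for s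
      by (rule measurable_from_subalg[OF sub ZG])
    ultimately show "{\<omega> \<in> E. \<exists>s. ennreal d \<le> Z s \<omega>} \<in> sets M"
      using EM by simp
  qed simp
  from order_trans[OF this upper] show ?thesis
    using d by (simp add: emeasure_eq_measure ennreal_mult[symmetric])
qed

section \<open>Posterior odds at a crossing\<close>

text \<open>The conditional probabilities of the two latent states add up to 1 almost surely, so
  odds of at least \<open>b\<close> leave at most \<open>1 / (1 + b)\<close> for state 0.\<close>

lemma AE_posterior_odds_imp_cprob_le:
  assumes \<Gamma>: "posterior_odds M X Y \<Theta> \<Gamma>" and b: "0 < b"
  shows "AE \<omega> in M. ennreal b \<le> \<Gamma> k \<omega> \<longrightarrow>
    cprob M (obs M X Y (enat k)) (\<lambda>\<omega>. latent \<Theta> k \<omega> = 0) \<omega> \<le> 1 / (1 + b)"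
proof -
  let ?F = "obs M X Y (enat k)"
  let ?L = "\<lambda>i. {\<omega> \<in> space M. latent \<Theta> k \<omega> = i}"
  let ?p = "\<lambda>i. real_cond_exp M ?F (indicator (?L i))"
  interpret F: finite_measure_subalgebra M ?F
    by unfold_locales (rule subalgebra_obs)
  note [measurable] = latent_measurable
  have [measurable]: "?L i \<in> sets M" for i
    by measurable
  have int: "integrable M (indicator (?L i) :: _ \<Rightarrow> real)" for i
    by (simp add: integrable_real_indicator less_top[symmetric])
  have nonneg: "AE \<omega> in M. 0 \<le> ?p i \<omega>" for i
    by (rule F.real_cond_exp_pos) auto
  have "AE \<omega> in M. real_cond_exp M ?F (\<lambda>\<omega>. indicator (?L 0) \<omega> + indicator (?L 1) \<omega>) \<omega> = ?p 0 \<omega> + ?p 1 \<omega>"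
    by (rule F.real_cond_exp_add) (rule int)+
  moreover have "AE \<omega> in M. real_cond_exp M ?F (\<lambda>\<omega>. indicator (?L 0) \<omega> + indicator (?L 1) \<omega>) \<omega> =
      real_cond_exp M ?F (\<lambda>_. 1) \<omega>"
  proof (rule F.real_cond_exp_cong)
    show "AE \<omega> in M. indicator (?L 0) \<omega> + indicator (?L 1) \<omega> = (1 :: real)"
      by (rule AE_I2) (auto simp: indicator_def latent_def)
  qed measurable
  moreover have "AE \<omega> in M. real_cond_exp M ?F (\<lambda>_. 1) \<omega> = 1"
    by (rule F.real_cond_exp_F_meas) auto
  moreover have "AE \<omega> in M. \<Gamma> k \<omega> = ennreal (?p 1 \<omega>) / ennreal (?p 0 \<omega>)"
    using \<Gamma> by (simp add: posterior_odds_def cprob_def)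
  ultimately have "AE \<omega> in M. ennreal b \<le> \<Gamma> k \<omega> \<longrightarrow> ?p 0 \<omega> \<le> 1 / (1 + b)"
    using nonneg[of 0] nonneg[of 1]
  proof eventually_elim
    case (elim \<omega>)
    show ?case
    proof
      assume le: "ennreal b \<le> \<Gamma> k \<omega>"
      show "?p 0 \<omega> \<le> 1 / (1 + b)"
      \<comment> \<open>Division by zero in \<open>ennreal\<close> is kept apart; in that case the
        bound is immediate.\<close>
      proof (cases "?p 0 \<omega> = 0")
        case False
        then have "ennreal b \<le> ennreal (?p 1 \<omega> / ?p 0 \<omega>)" "0 < ?p 0 \<omega>"
          using elim le by (simp_all add: divide_ennreal)
        then have "b * ?p 0 \<omega> \<le> ?p 1 \<omega>"
          using elim by (simp add: pos_le_divide_eq)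
        then have "(1 + b) * ?p 0 \<omega> \<le> 1"
          using elim by (simp add: algebra_simps)
        then show ?thesis
          using b by (simp add: pos_le_divide_eq mult.commute)
      qed (use b in simp)
    qed
  qed
  then show ?thesis
    by (simp add: cprob_def)
qed

end

text \<open>A finite end of an odd-numbered stage means that the infimum defining its wait is
  finite, hence attained. Applying the order characterization once at the wait \<open>i\<close> and
  once at the witness \<open>s\<close> shows \<open>s = i\<close>.\<close>

lemma stage_time_Suc_even_crossing:
  assumes "stage_time \<Gamma> \<Lambda> b1 b2 d (Suc m) \<omega> = enat k" "even m"
  shows "ennreal b1 \<le> \<Gamma> k \<omega>"
proof -
  obtain j where j: "stage_time \<Gamma> \<Lambda> b1 b2 d m \<omega> = enat j"
    using assms by (cases "stage_time \<Gamma> \<Lambda> b1 b2 d m \<omega>") (auto simp: Let_def)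
  obtain i where i: "sigma_time \<Gamma> b1 (enat j) \<omega> = enat i" "k = j + i"
    using assms j by (cases "sigma_time \<Gamma> b1 (enat j) \<omega>") (auto simp: Let_def)
  obtain s where s: "s \<le> i" "ennreal b1 \<le> \<Gamma> (j + s) \<omega>"
    using i sigma_time_le_iff[of \<Gamma> b1 j \<omega> i] by auto
  have "sigma_time \<Gamma> b1 (enat j) \<omega> \<le> enat s"
    using s unfolding sigma_time_le_iff by blast
  with i s show ?thesis
    by auto
qed

section \<open>Transfer of both bounds to the random time\<close>

theorem lemmaC1:
  fixes M :: "'w measure"
    and \<mu> :: "'y::polish_space measure"
    and K :: nat
    and f g :: "nat \<Rightarrow> 'y \<Rightarrow> real"
    and p :: "nat list \<Rightarrow> real"
    and \<Theta> :: "'w \<Rightarrow> enat"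
    and X :: "nat \<Rightarrow> 'w \<Rightarrow> nat"
    and Y :: "nat \<Rightarrow> 'w \<Rightarrow> 'y"
    and \<Gamma> \<Lambda> :: "nat \<Rightarrow> 'w \<Rightarrow> ennreal"
    and \<Xi>1 \<Xi>2 :: "nat list"
    and b1 b2 d :: real
    and S :: "nat \<Rightarrow> 'w \<Rightarrow> enat"
    and T :: "'w \<Rightarrow> enat"
    and \<F>S :: "nat \<Rightarrow> 'w measure"
    and B :: "nat \<Rightarrow> 'w \<Rightarrow> bool"
    and n :: nat
  assumes "change_point_model M \<mu> K f g p \<Theta> X Y"
    and "posterior_odds M X Y \<Theta> \<Gamma>"
    and "\<Lambda> = lik_ratio f g X Y"
    and "block K \<Xi>1" and "block K \<Xi>2"
    and "1 \<le> b1" and "b1 \<le> b2" and "1 \<le> d"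
    and "proposed_rule M X \<Gamma> \<Lambda> \<Xi>1 \<Xi>2 b1 b2 d"
    and "S = stage_time \<Gamma> \<Lambda> b1 b2 d"
    and "T = alarm_time \<Gamma> \<Lambda> b1 b2 d"
    and "\<F>S = (\<lambda>n. filtration.pre_sigma (space M) (obs M X Y) (S n))"
    and "B = (\<lambda>n \<omega>. tau_time \<Lambda> d (S n \<omega>) \<omega> < sigma_time \<Gamma> b2 (S n \<omega>) \<omega>)"
    and "odd n"
  shows "AE \<omega> in M. S n \<omega> < T \<omega> \<longrightarrow>
      cprob M (\<F>S n) (\<lambda>\<omega>. S n \<omega> < \<infinity> \<and> latent \<Theta> (the_enat (S n \<omega>)) \<omega> = 0) \<omega>
        \<le> 1 / (1 + b1) \<and>
      cprob M (\<F>S n) (\<lambda>\<omega>. B n \<omega> \<and> S n \<omega> < \<infinity> \<and> latent \<Theta> (the_enat (S n \<omega>)) \<omega> = 1) \<omega>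
        \<le> 1 / d * cprob M (\<F>S n) (\<lambda>\<omega>. S n \<omega> < \<infinity> \<and> latent \<Theta> (the_enat (S n \<omega>)) \<omega> = 1) \<omega>"
proof -
  interpret change_point_model M \<mu> K f g p \<Theta> X Y
    by fact
  interpret Fil: filtration "space M" "obs M X Y"
    by (rule filtration_obs)
  note \<Lambda> = \<open>\<Lambda> = lik_ratio f g X Y\<close> and S = \<open>S = stage_time \<Gamma> \<Lambda> b1 b2 d\<close>
    and B = \<open>B = (\<lambda>n \<omega>. tau_time \<Lambda> d (S n \<omega>) \<omega> < sigma_time \<Gamma> b2 (S n \<omega>) \<omega>)\<close>
  let ?V = "\<lambda>i. {\<omega> \<in> space M. S n \<omega> < \<infinity> \<and> latent \<Theta> (the_enat (S n \<omega>)) \<omega> = i}"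
  let ?BV = "{\<omega> \<in> space M. B n \<omega> \<and> S n \<omega> < \<infinity> \<and> latent \<Theta> (the_enat (S n \<omega>)) \<omega> = 1}"
  let ?F = "Fil.pre_sigma (S n)"
  have \<Gamma>_obs: "\<Gamma> t \<in> borel_measurable (obs M X Y (enat t))" for t
    using \<open>posterior_odds M X Y \<Theta> \<Gamma>\<close> by (simp add: posterior_odds_def)
  have \<Lambda>_obs: "\<Lambda> t \<in> borel_measurable (obs M X Y (enat t))" if "1 \<le> t" for t
    unfolding \<Lambda> by (rule lik_ratio_measurable[OF that])
  have st: "stopping_time (obs M X Y) (S n)"
    unfolding S by (rule stopping_time_obs_stage_time[OF \<Gamma>_obs \<Lambda>_obs])
  have F_subset: "sets ?F \<subseteq> sets M"
  proof
    fix A assume "A \<in> sets ?F"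
    \<comment> \<open>The bound by \<infinity> cuts nothing off, so \<open>A\<close> itself is an
      event of the full observation sigma-algebra.\<close>
    from Fil.sets_pre_sigmaD[OF st this, of \<infinity>] show "A \<in> sets M"
      using subalgebra_obs[of \<infinity>] by (auto simp: subalgebra_def)
  qed
  interpret F: finite_measure_subalgebra M ?F
    by unfold_locales (simp add: subalgebra_def Fil.space_pre_sigma F_subset)
  have D: "{\<omega> \<in> space M. S n \<omega> = enat k} \<in> sets ?F" for k
    using measurable_sets[OF Fil.measurable_stopping_time_pre_sigma[OF st], of "{enat k}"]
    by (simp add: Fil.space_pre_sigma vimage_def Int_def conj_commute)
  have E_obs: "E \<in> sets (obs M X Y (enat k))"
    if "E \<in> sets ?F" "E \<subseteq> {\<omega> \<in> space M. S n \<omega> = enat k}" for E k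
  proof -
    have "{\<omega> \<in> E. S n \<omega> \<le> enat k} = E"
      using that by auto
    then show ?thesis
      using Fil.sets_pre_sigmaD[OF st that(1), of "enat k"] by simp
  qed
  note [measurable] = latent_measurable measurable_from_subalg[OF subalgebra_obs \<Gamma>_obs]
  have [measurable]: "Measurable.pred M (\<lambda>\<omega>. S n \<omega> = enat k)" for k
    using D F_subset by (auto simp: pred_def)
  have V[measurable]: "?V i \<in> sets M" for i
  proof -
    have "?V i = {\<omega> \<in> space M. \<exists>k. S n \<omega> = enat k \<and> latent \<Theta> k \<omega> = i}"
      by auto
    then show ?thesis
      by simp
  qed
  have BV[measurable]: "?BV \<in> sets M"
  proof -
    have "(\<lambda>\<omega>. \<Prod>j=1..s. \<Lambda> (k + j) \<omega>) \<in> borel_measurable M" for s k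
      by (intro borel_measurable_prod_ennreal measurable_from_subalg[OF subalgebra_obs \<Lambda>_obs]) simp
    note [measurable] = this
    \<comment> \<open>A finite separating time turns the strict comparison of two waiting times into
      a countable combination of bounds already characterized.\<close>
    have less_iff: "x < y \<longleftrightarrow> (\<exists>i. x \<le> enat i \<and> \<not> y \<le> enat i)" for x y :: enat
      by (cases x) (auto simp: not_le intro: le_less_trans[of _ "enat _"])
    have "?BV = {\<omega> \<in> space M. \<exists>k. S n \<omega> = enat k \<and> latent \<Theta> k \<omega> = 1 \<and>
        tau_time \<Lambda> d (enat k) \<omega> < sigma_time \<Gamma> b2 (enat k) \<omega>}"
      unfolding B by auto
    also have "\<dots> \<in> sets M"
      unfolding less_iff sigma_time_le_iff tau_time_le_iff by measurable
    finally show ?thesis .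
  qed
  have int: "integrable M (indicator A :: _ \<Rightarrow> real)" if "A \<in> sets M" for A
    using that by (simp add: integrable_real_indicator less_top[symmetric])
  have ind: "(LINT \<omega>:E|M. indicator A \<omega>) = prob (E \<inter> A)" if "E \<in> sets M" "A \<in> sets M" for E A
    using that by (simp add: set_lebesgue_integral_def indicator_inter_arith[symmetric])
  \<comment> \<open>The constant is written as a conditional expectation to fit the comparison
    lemma, and is evaluated only at the end.\<close>
  have first: "AE \<omega> in M. \<omega> \<in> {\<omega> \<in> space M. S n \<omega> = enat k} \<longrightarrow>
      real_cond_exp M ?F (indicator (?V 0)) \<omega> \<le> real_cond_exp M ?F (\<lambda>_. 1 / (1 + b1)) \<omega>" for k
  proof (rule F.AE_real_cond_exp_le_on[OF D])
    fix E assume E: "E \<in> sets ?F" "E \<subseteq> {\<omega> \<in> space M. S n \<omega> = enat k}"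
    then have EM: "E \<in> sets M"
      using F_subset by blast
    let ?L = "{\<omega> \<in> space M. latent \<Theta> k \<omega> = 0}"
    interpret Fk: finite_measure_subalgebra M "obs M X Y (enat k)"
      by unfold_locales (rule subalgebra_obs)
    have L: "?L \<in> sets M"
      by measurable
    obtain m where m: "n = Suc m" "even m"
      using \<open>odd n\<close> by (cases n) auto
    have cross: "ennreal b1 \<le> \<Gamma> k \<omega>" if "\<omega> \<in> E" for \<omega>
      using that E stage_time_Suc_even_crossing[of \<Gamma> \<Lambda> b1 b2 d m \<omega> k] m by (auto simp: S)
    have "(LINT \<omega>:E|M. indicator (?V 0) \<omega>) = (LINT \<omega>:E|M. indicator ?L \<omega> :: real)"
      using E unfolding set_lebesgue_integral_def
      by (intro Bochner_Integration.integral_cong) (auto simp: indicator_def)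
    \<comment> \<open>Since \<open>E\<close> is an event of time \<open>k\<close>, conditioning at
      the fixed time \<open>k\<close> leaves its integral unchanged, and the posterior bound can be
      used pointwise.\<close>
    also have "\<dots> = (LINT \<omega>:E|M. real_cond_exp M (obs M X Y (enat k)) (indicator ?L) \<omega>)"
      by (rule Fk.real_cond_exp_intA[OF int[OF L] E_obs[OF E]])
    also have "\<dots> \<le> (LINT \<omega>:E|M. 1 / (1 + b1))"
    proof (rule set_integral_mono_AE)
      show "set_integrable M E (real_cond_exp M (obs M X Y (enat k)) (indicator ?L))"
        unfolding set_integrable_def
        by (rule integrable_mult_indicator[OF EM Fk.real_cond_exp_int(1)[OF int[OF L]]])
      show "set_integrable M E (\<lambda>_. 1 / (1 + b1))"
        unfolding set_integrable_def using EM by (intro integrable_mult_indicator) auto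
      show "AE \<omega>\<in>E in M. real_cond_exp M (obs M X Y (enat k)) (indicator ?L) \<omega> \<le> 1 / (1 + b1)"
        using AE_posterior_odds_imp_cprob_le[OF \<open>posterior_odds M X Y \<Theta> \<Gamma>\<close>, of b1 k] \<open>1 \<le> b1\<close> cross
        unfolding cprob_def by auto
    qed
    finally show "(LINT \<omega>:E|M. indicator (?V 0) \<omega>) \<le> (LINT \<omega>:E|M. 1 / (1 + b1))" .
  qed (use int V in auto)
  have second: "AE \<omega> in M. \<omega> \<in> {\<omega> \<in> space M. S n \<omega> = enat k} \<longrightarrow>
      real_cond_exp M ?F (indicator ?BV) \<omega> \<le> real_cond_exp M ?F (\<lambda>\<omega>. 1 / d * indicator (?V 1) \<omega>) \<omega>" for k
  proof (rule F.AE_real_cond_exp_le_on[OF D])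
    fix E assume E: "E \<in> sets ?F" "E \<subseteq> {\<omega> \<in> space M. S n \<omega> = enat k}"
    then have EM: "E \<in> sets M"
      using F_subset by blast
    let ?C = "{\<omega> \<in> E. latent \<Theta> k \<omega> = 1 \<and> (\<exists>s. (\<Prod>j=1..s. \<Lambda> (k + j) \<omega>) \<le> ennreal (1 / d))}"
    \<comment> \<open>Being strictly below another waiting time forces this one to be finite, so the
      product does reach the threshold.\<close>
    have tau: "\<exists>s. (\<Prod>j=1..s. \<Lambda> (k + j) \<omega>) \<le> ennreal (1 / d)" if "tau_time \<Lambda> d (enat k) \<omega> < y" for \<omega> y
    proof -
      obtain i where "tau_time \<Lambda> d (enat k) \<omega> \<le> enat i"
        using \<open>tau_time \<Lambda> d (enat k) \<omega> < y\<close> by (cases "tau_time \<Lambda> d (enat k) \<omega>") auto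
      then show ?thesis
        unfolding tau_time_le_iff by blast
    qed
    have "prob (E \<inter> ?BV) \<le> prob ?C"
    proof (rule finite_measure_mono)
      show "E \<inter> ?BV \<subseteq> ?C"
      proof
        fix \<omega> assume \<omega>: "\<omega> \<in> E \<inter> ?BV"
        then have "S n \<omega> = enat k"
          using E by auto
        then show "\<omega> \<in> ?C"
          using \<omega> tau[of \<omega> "sigma_time \<Gamma> b2 (enat k) \<omega>"] by (simp add: B)
      qed
      have "(\<lambda>\<omega>. \<Prod>j=1..s. \<Lambda> (k + j) \<omega>) \<in> borel_measurable M" for s
        by (intro borel_measurable_prod_ennreal measurable_from_subalg[OF subalgebra_obs \<Lambda>_obs]) simp
      note [measurable] = this
      have "?C = E \<inter> {\<omega> \<in> space M. latent \<Theta> k \<omega> = 1 \<and> (\<exists>s. (\<Prod>j=1..s. \<Lambda> (k + j) \<omega>) \<le> ennreal (1 / d))}"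
        using E by auto
      also have "\<dots> \<in> sets M"
        by (rule sets.Int[OF EM]) measurable
      finally show "?C \<in> sets M" .
    qed
    also have "\<dots> \<le> 1 / d * prob {\<omega> \<in> E. latent \<Theta> k \<omega> = 1}"
      using post_change_lik_ratio_maximal[OF E_obs[OF E], of d] \<open>1 \<le> d\<close> unfolding \<Lambda>
      by (simp add: field_simps)
    also have "{\<omega> \<in> E. latent \<Theta> k \<omega> = 1} = E \<inter> ?V 1"
      using E by auto
    also have "1 / d * prob (E \<inter> ?V 1) = (LINT \<omega>:E|M. 1 / d * indicator (?V 1) \<omega>)"
      unfolding set_integral_mult_right by (subst ind) (use EM V in auto)
    finally show "(LINT \<omega>:E|M. indicator ?BV \<omega>) \<le> (LINT \<omega>:E|M. 1 / d * indicator (?V 1) \<omega>)"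
      using ind[OF EM BV] by simp
  qed (use int V BV in auto)
  \<comment> \<open>There are countably many finite values of \<open>S n\<close>, so the exceptional
    null sets can be combined.\<close>
  have "AE \<omega> in M. \<forall>k. S n \<omega> = enat k \<longrightarrow>
      real_cond_exp M ?F (indicator (?V 0)) \<omega> \<le> real_cond_exp M ?F (\<lambda>_. 1 / (1 + b1)) \<omega> \<and>
      real_cond_exp M ?F (indicator ?BV) \<omega> \<le> real_cond_exp M ?F (\<lambda>\<omega>. 1 / d * indicator (?V 1) \<omega>) \<omega>"
    unfolding AE_all_countable
  proof
    fix k
    show "AE \<omega> in M. S n \<omega> = enat k \<longrightarrow>
      real_cond_exp M ?F (indicator (?V 0)) \<omega> \<le> real_cond_exp M ?F (\<lambda>_. 1 / (1 + b1)) \<omega> \<and>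
      real_cond_exp M ?F (indicator ?BV) \<omega> \<le> real_cond_exp M ?F (\<lambda>\<omega>. 1 / d * indicator (?V 1) \<omega>) \<omega>"
      using first[of k] second[of k] AE_space by eventually_elim auto
  qed
  moreover have "AE \<omega> in M. real_cond_exp M ?F (\<lambda>_. 1 / (1 + b1)) \<omega> = 1 / (1 + b1)"
    by (rule F.real_cond_exp_F_meas) auto
  moreover have "AE \<omega> in M. real_cond_exp M ?F (\<lambda>\<omega>. 1 / d * indicator (?V 1) \<omega>) \<omega> =
      1 / d * real_cond_exp M ?F (indicator (?V 1)) \<omega>"
    by (rule F.real_cond_exp_cmult[OF int[OF V]])
  ultimately have "AE \<omega> in M. S n \<omega> < T \<omega> \<longrightarrow>
      real_cond_exp M ?F (indicator (?V 0)) \<omega> \<le> 1 / (1 + b1) \<and>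
      real_cond_exp M ?F (indicator ?BV) \<omega> \<le> 1 / d * real_cond_exp M ?F (indicator (?V 1)) \<omega>"
  proof eventually_elim
    case (elim \<omega>)
    \<comment> \<open>\<open>S n \<omega> < T \<omega>\<close> makes \<open>S n \<omega>\<close>
      finite, so one of the pieces treated above applies.\<close>
    then show ?case
      by (cases "S n \<omega>") auto
  qed
  then show ?thesis
    unfolding cprob_def \<open>\<F>S = (\<lambda>n. Fil.pre_sigma (S n))\<close> .
qed

end
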